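(* In dimension $d\ge 3$, it is possible to choose $d-1$ polytopes so that the trivial upper bound for the number of vertices of their Minkowski sum is attained. That is, for every $d\ge 3$ there exist $d$-dimensional polytopes $P_1,\dots,P_{d-1}$ in $\mathbb{R}^d$ such that $$f_0(P_1+\cdots+P_{d-1})=\prod_{i=1}^{d-1} f_0(P_i).$$
   Context: $f_0(P)$ denotes the number of vertices of a convex polytope $P$, and $P_1+\cdots+P_m=\{x_1+\cdots+x_m: x_i\in P_i\}$ is the Minkowski sum. The trivial upper bound on the number of vertices of a Minkowski sum is $f_0(P_1+\cdots+P_m)\le\prod_{i=1}^m f_0(P_i)$; it holds because each vertex of the sum decomposes, in a unique way, as a sum of vertices of the summands. *)

theory Defs
  imports "HOL-Analysis.Analysis" "HOL-Library.Set_Algebras"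
begin

definition f0 :: "'a::real_vector set \<Rightarrow> nat" where
  "f0 P = card {v. v extreme_point_of P}"

text \<open>
  With \<open>Set_Algebras\<close>, the type of sets over a commutative monoid is itself a commutative
  monoid under elementwise addition, so \<open>sum P I\<close> on a family of sets is a Minkowski sum.
\<close>
lemma minkowski_sum_eq:
  fixes P :: "'i \<Rightarrow> 'a::comm_monoid_add set"
  assumes "finite I"
  shows "(\<Sum>i\<in>I. P i) = {\<Sum>i\<in>I. x i | x. \<forall>i\<in>I. x i \<in> P i}"
  using set_sum_alt[OF assms, of P] by simp

end

theory Submission
  imports Defs
begin

text \<open>
  The points \<open>t e\<^sub>i + t\<^sup>2 e\<^sub>d\<close> form a parabola in a coordinate plane, and the sums over \<open>i < d\<close> of
  points on these \<open>d - 1\<close> parabolas lie on the strictly convex paraboloid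
  \<open>x\<^sub>d = x\<^sub>1\<^sup>2 + \<dots> + x\<^sub>d\<^sub>-\<^sub>1\<^sup>2\<close>, so every sum of vertices is a vertex. Being uniquely minimised by
  a linear functional is stable under perturbations that are small relative to the polygons. After
  scaling the parabolas by a large \<open>M\<close>, we may therefore move the \<open>k\<close>-th of the \<open>d + 1\<close> points
  \<open>t = 0, \<dots>, d\<close> on each parabola by \<open>e\<^sub>k\<close> (for \<open>k \<ge> 1\<close>), which makes each polygon a \<open>d\<close>-simplex.
\<close>

text \<open>The functional \<open>w\<close> puts the hull of the other points into an open
  half-space that misses \<open>x\<close>, so \<open>x\<close> lies outside that hull and stays
  extreme when it is added.\<close>

lemma extreme_points_convex_hull_exposed:
  fixes X :: "'a::euclidean_space set"
  assumes "finite X"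
    and exposed: "\<And>x. x \<in> X \<Longrightarrow> \<exists>w. \<forall>y\<in>X - {x}. w \<bullet> x < w \<bullet> y"
  shows "{v. v extreme_point_of (convex hull X)} = X"
proof
  show "{v. v extreme_point_of (convex hull X)} \<subseteq> X"
    by (auto dest: extreme_point_of_convex_hull)
  show "X \<subseteq> {v. v extreme_point_of (convex hull X)}"
  proof
    fix x assume x: "x \<in> X"
    then obtain w where w: "\<forall>y\<in>X - {x}. w \<bullet> x < w \<bullet> y"
      using exposed by blast
    have "convex hull (X - {x}) \<subseteq> {y. w \<bullet> y > w \<bullet> x}"
      using w by (intro hull_minimal convex_halfspace_gt) auto
    then have "x \<notin> convex hull (X - {x})"
      by blast
    with \<open>finite X\<close> have "x extreme_point_of (convex hull (insert x (X - {x})))"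
      by (intro extreme_point_of_convex_hull_insert) auto
    with x show "x \<in> {v. v extreme_point_of (convex hull X)}"
      by (simp add: insert_absorb)
  qed
qed

text \<open>One \<open>w\<close> serves all summands at once: adding the inequalities over
  \<open>I\<close> shows that it is minimised over all sums of choices only at the choice
  \<open>s\<close>. Hence every such sum is exposed, and different choices have different
  sums.\<close>

lemma f0_sum_convex_hull_exposed:
  fixes V :: "'i \<Rightarrow> 'a::euclidean_space set"
  assumes I: "finite I" and V: "\<And>i. i \<in> I \<Longrightarrow> finite (V i)"
    and exposed: "\<And>s. s \<in> PiE I V \<Longrightarrow> \<exists>w. \<forall>i\<in>I. \<forall>y\<in>V i - {s i}. w \<bullet> s i < w \<bullet> y"
  shows "f0 (\<Sum>i\<in>I. convex hull (V i)) = (\<Prod>i\<in>I. card (V i))"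
proof -
  define S where "S s = (\<Sum>i\<in>I. s i)" for s :: "'i \<Rightarrow> 'a"
  have less: "\<exists>w. \<forall>t\<in>PiE I V - {s}. w \<bullet> S s < w \<bullet> S t" if s: "s \<in> PiE I V" for s
  proof -
    obtain w where w: "\<forall>i\<in>I. \<forall>y\<in>V i - {s i}. w \<bullet> s i < w \<bullet> y"
      using exposed[OF s] by blast
    have "w \<bullet> S s < w \<bullet> S t" if t: "t \<in> PiE I V" "t \<noteq> s" for t
    proof -
      have "\<exists>i\<in>I. t i \<noteq> s i"
        using s t PiE_ext by metis
      moreover have lt: "w \<bullet> s i < w \<bullet> t i" if "i \<in> I" "t i \<noteq> s i" for i
        using that w PiE_mem[OF t(1)] by auto
      moreover have "w \<bullet> s i \<le> w \<bullet> t i" if "i \<in> I" for i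
        using that lt by (cases "t i = s i") (auto intro: less_imp_le)
      ultimately have "(\<Sum>i\<in>I. w \<bullet> s i) < (\<Sum>i\<in>I. w \<bullet> t i)"
        using I by (intro sum_strict_mono_ex1) auto
      then show ?thesis
        by (simp add: S_def inner_sum_right)
    qed
    then show ?thesis by blast
  qed
  have sumV: "(\<Sum>i\<in>I. V i) = S ` PiE I V"
  proof -
    have "(\<Sum>i\<in>I. x i) \<in> S ` PiE I V" if "\<forall>i\<in>I. x i \<in> V i" for x
      using that by (intro image_eqI[where x = "restrict x I"]) (auto simp: S_def)
    then show ?thesis
      by (auto simp: minkowski_sum_eq[OF I] S_def PiE_iff)
  qed
  have inj: "inj_on S (PiE I V)"
    by (rule inj_onI) (metis less Diff_iff less_irrefl singletonD)
  have "(\<Sum>i\<in>I. convex hull (V i)) = convex hull (S ` PiE I V)"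
    by (simp flip: convex_hull_set_sum sumV)
  moreover have "{v. v extreme_point_of (convex hull (S ` PiE I V))} = S ` PiE I V"
  proof (rule extreme_points_convex_hull_exposed)
    show "finite (S ` PiE I V)"
      using I V by (simp add: finite_PiE)
    show "\<exists>w. \<forall>y\<in>S ` PiE I V - {x}. w \<bullet> x < w \<bullet> y" if x: "x \<in> S ` PiE I V" for x
    proof -
      obtain s where s: "s \<in> PiE I V" "x = S s"
        using x by blast
      then obtain w where "\<forall>t\<in>PiE I V - {s}. w \<bullet> S s < w \<bullet> S t"
        using less by blast
      then have "\<forall>y\<in>S ` PiE I V - {x}. w \<bullet> x < w \<bullet> y"
        using s(2) by auto
      then show ?thesis ..
    qed
  qed
  ultimately have "f0 (\<Sum>i\<in>I. convex hull (V i)) = card (S ` PiE I V)"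
    by (simp only: f0_def)
  then show ?thesis
    by (simp only: card_image[OF inj] card_PiE[OF I])
qed

theorem theorem2:
  assumes "CARD('n::finite) \<ge> 3"
  shows "\<exists>P :: nat \<Rightarrow> (real ^ 'n) set.
           (\<forall>i\<in>{1..CARD('n) - 1}. polytope (P i) \<and> aff_dim (P i) = int CARD('n)) \<and>
           f0 (\<Sum>i=1..CARD('n) - 1. P i) = (\<Prod>i=1..CARD('n) - 1. f0 (P i))"
proof -
  define d where "d = CARD('n)"
  have d: "d \<ge> 1" using assms by (simp add: d_def)
  obtain h :: "nat \<Rightarrow> 'n" where h: "bij_betw h {1..d} UNIV"
    using ex_bij_betw_nat_finite_1[of "UNIV :: 'n set"] by (auto simp: d_def)
  \<comment> \<open>The value \<open>e 0 = 0\<close> leaves the point with \<open>k = 0\<close>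
    unperturbed, so that \<open>p i 0 = 0\<close>.\<close>
  define e :: "nat \<Rightarrow> real ^ 'n" where "e k = (if k = 0 then 0 else axis (h k) 1)" for k
  have e_inner: "e k \<bullet> e l = (if k = l then 1 else 0)" if "k \<in> {1..d}" "l \<in> {1..d}" for k l
    using that bij_betw_imp_inj_on[OF h] by (simp add: e_def inner_axis_axis inj_on_eq_iff)
  \<comment> \<open>Two perturbation terms, each at most \<open>2 * d\<close> in absolute value,
    have to be outweighed by \<open>M\<close> times the square of a nonzero integer.\<close>
  define M where "M = 4 * real d + 1"
  define p where "p i k = (M * real k) *\<^sub>R e i + (M * real k ^ 2) *\<^sub>R e d + e k" for i k
  define V where "V i = p i ` {0..d}" for i
  have finV: "finite (V i)" for i
    by (simp add: V_def)
  \<comment> \<open>The index set is kept general: all of \<open>{1..d - 1}\<close> handles the sum,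
    a singleton handles one polytope alone.\<close>
  have exposed: "\<exists>w. \<forall>i\<in>I. \<forall>y\<in>V i - {s i}. w \<bullet> s i < w \<bullet> y"
    if I: "I \<subseteq> {1..d - 1}" and s: "s \<in> PiE I V" for I s
  proof -
    have "\<forall>i\<in>I. \<exists>k\<in>{0..d}. s i = p i k"
      using s by (auto simp: V_def PiE_iff)
    then obtain j where j: "\<And>i. i \<in> I \<Longrightarrow> j i \<le> d \<and> s i = p i (j i)"
      by (metis atLeastAtMost_iff)
    \<comment> \<open>On the unscaled \<open>i\<close>-th parabola this gives
      \<open>t\<^sup>2 - 2 * j i * t\<close>, which is minimal exactly at \<open>t = j i\<close>.
      The entry at \<open>d\<close> causes no clash, as \<open>I\<close> stops at
      \<open>d - 1\<close>.\<close>
    define c where "c l = (if l = d then 1 else if l \<in> I then - 2 * real (j l) else 0)" for l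
    define w where "w = (\<Sum>l\<in>{1..d}. c l *\<^sub>R e l)"
    have w_e: "w \<bullet> e k = c k" if "k \<in> {1..d}" for k
      using that by (simp add: w_def inner_sum_left e_inner if_distrib cong: if_cong)
    have w_bound: "\<bar>w \<bullet> e k\<bar> \<le> 2 * real d" if "k \<le> d" for k
      using that j d w_e[of k] by (cases "k = 0") (auto simp: e_def c_def)
    have "w \<bullet> s i < w \<bullet> y" if i: "i \<in> I" and y: "y \<in> V i - {s i}" for i y
    proof -
      obtain k where k: "k \<le> d" "y = p i k" "k \<noteq> j i"
        using y j[OF i] by (fastforce simp: V_def)
      have "c i = - 2 * real (j i)" "c d = 1" "i \<in> {1..d}" "d \<in> {1..d}"
        using subsetD[OF I i] i d by (auto simp: c_def)
      then have wp: "w \<bullet> p i l = M * ((real l - real (j i))\<^sup>2 - (real (j i))\<^sup>2) + w \<bullet> e l" for l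
        by (simp add: p_def w_e power2_eq_square algebra_simps)
      have "1 \<le> \<bar>real k - real (j i)\<bar>"
        using k by linarith
      then have "1 \<le> (real k - real (j i))\<^sup>2"
        by (metis one_le_power power2_abs)
      then have "M \<le> M * (real k - real (j i))\<^sup>2"
        by (simp add: M_def)
      moreover have "w \<bullet> y - w \<bullet> s i = M * (real k - real (j i))\<^sup>2 + w \<bullet> e k - w \<bullet> e (j i)"
        using k j[OF i] by (simp add: wp algebra_simps)
      ultimately show ?thesis
        using w_bound[of k] w_bound[of "j i"] k(1) j[OF i] M_def by linarith
    qed
    then show ?thesis by blast
  qed
  have f0_hull: "f0 (convex hull (V i)) = card (V i)" if "i \<in> {1..d - 1}" for i
    using f0_sum_convex_hull_exposed[of "{i}" V] exposed[of "{i}"] that finV by auto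
  have f0_sum: "f0 (\<Sum>i=1..d - 1. convex hull (V i)) = (\<Prod>i=1..d - 1. card (V i))"
    using exposed finV by (intro f0_sum_convex_hull_exposed) auto
  have full: "aff_dim (convex hull (V i)) = int d" if i: "i \<in> {1..d - 1}" for i
  proof -
    have id: "i < d" using i by auto
    \<comment> \<open>Otherwise the vertices lie in a hyperplane, which passes through the origin
      because \<open>p i 0 = 0\<close>. It remains to show that its normal \<open>u\<close>
      vanishes.\<close>
    have "interior (convex hull (V i)) \<noteq> {}"
    proof
      assume "interior (convex hull (V i)) = {}"
      then obtain u b where u: "u \<noteq> 0" "convex hull (V i) \<subseteq> {x. u \<bullet> x = b}"
        using empty_interior_subset_hyperplane[OF convex_convex_hull] by metis
      have "u \<bullet> p i k = b" if "k \<le> d" for k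
        using u(2) hull_inc[of "p i k" "V i"] that by (auto simp: V_def)
      moreover have "p i 0 = 0"
        by (simp add: p_def e_def)
      ultimately have "u \<bullet> p i k = 0" if "k \<le> d" for k
        using that by (metis inner_zero_right le0)
      then have eq: "u \<bullet> e k = - (M * k * (u \<bullet> e i)) - M * k\<^sup>2 * (u \<bullet> e d)" if "k \<le> d" for k
        using that by (simp add: p_def inner_add_right) (smt (verit))
      define a where "a = u \<bullet> e i"
      define z where "z = u \<bullet> e d"
      \<comment> \<open>By \<open>eq\<close>, all coordinates of \<open>u\<close> are determined by
        \<open>a\<close> and \<open>z\<close>; the cases \<open>k = i\<close> and
        \<open>k = d\<close> are a homogeneous linear system for these two alone.\<close>
      have a: "a * (1 + M * i) = - (M * i\<^sup>2 * z)" and z: "z * (1 + M * d\<^sup>2) = - (M * d * a)"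
        using eq[of i] eq[of d] id unfolding a_def z_def by (simp_all add: algebra_simps)
      have "a * ((1 + M * i) * (1 + M * d\<^sup>2)) = - (M * i\<^sup>2 * (z * (1 + M * d\<^sup>2)))"
        by (simp only: a flip: mult.assoc) simp
      then have "a * (1 + M * i + M * d\<^sup>2 + M\<^sup>2 * i * d * (real d - real i)) = 0"
        unfolding z by (simp add: algebra_simps power2_eq_square)
      \<comment> \<open>The left factor is the determinant of \<open>(p i k)\<close> for \<open>k = 1, \<dots>, d\<close>.\<close>
      moreover have "1 + M * i + M * d\<^sup>2 + M\<^sup>2 * i * d * (real d - real i) > 0"
        using id by (intro add_pos_nonneg) (auto simp: M_def)
      ultimately have "a = 0" by simp
      moreover have "1 + M * d\<^sup>2 > 0"
        by (intro add_pos_nonneg) (auto simp: M_def)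
      ultimately have "z = 0" using z by auto
      have "u \<bullet> e k = 0" if "k \<le> d" for k
        using eq[OF that] \<open>a = 0\<close> \<open>z = 0\<close> by (simp add: a_def z_def)
      moreover have "\<exists>k\<in>{1..d}. h k = m" for m
        using h by (metis bij_betw_imp_surj_on imageE UNIV_I)
      ultimately have "u $ m = 0" for m
        by (metis atLeastAtMost_iff e_def inner_axis inner_real_def mult.right_neutral not_one_le_zero)
      then show False
        using u(1) by (simp add: vec_eq_iff)
    qed
    then show ?thesis
      by (simp add: aff_dim_nonempty_interior d_def)
  qed
  show ?thesis
  proof (intro exI[where x = "\<lambda>i. convex hull (V i)"] conjI ballI)
    fix i assume "i \<in> {1..CARD('n) - 1}"
    then show "aff_dim (convex hull (V i)) = int CARD('n)"
      using full unfolding d_def by blast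
    show "polytope (convex hull (V i))"
      using finV by (rule polytope_convex_hull)
  next
    show "f0 (\<Sum>i=1..CARD('n) - 1. convex hull (V i)) = (\<Prod>i=1..CARD('n) - 1. f0 (convex hull (V i)))"
      using f0_sum f0_hull by (simp add: d_def)
  qed
qed

end
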